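(* Let $n,m,r$ be positive integers, $X\in\mathbb{R}^{n\times m}_{\ge 0}$ and $Y\in\mathbb{R}^n$. Let $0\le\lambda_1<\lambda_2$ be real numbers and, for $i=1,2$, let $(W^{(\lambda_i)},H^{(\lambda_i)},\theta^{(\lambda_i)})$ be a global minimizer of the CSSNMF problem with weight $\lambda_i$ for the data $(X,Y)$, assumed to be unique up to the rescaling equivalence (as defined in the context). Then $$R(W^{(\lambda_2)},\theta^{(\lambda_2)};Y)\le R(W^{(\lambda_1)},\theta^{(\lambda_1)};Y).$$
   Context: Fix positive integers $n,m,r$, a matrix $X\in\mathbb{R}^{n\times m}_{\ge 0}$ (entrywise nonnegative) and a vector $Y\in\mathbb{R}^n$. For $W\in\mathbb{R}^{n\times r}_{\ge 0}$, $H\in\mathbb{R}^{r\times m}_{\ge 0}$, $\theta\in\mathbb{R}^{r+1}$ define $$N(W,H;X)=\|X-WH\|_F^2,\qquad R(W,\theta;Y)=\|\bar W\theta-Y\|^2,$$ $$F^{(\lambda)}(W,H,\theta;X,Y)=N(W,H;X)+\lambda R(W,\theta;Y),$$ where $\|\cdot\|_F$ is the Frobenius norm, $\|\cdot\|$ is the Euclidean norm, and $\bar W\in\mathbb{R}^{n\times(r+1)}$ is the matrix obtained from $W$ by prepending a column of ones, i.e. $(\bar W\theta)_i=\theta_1+\sum_{k=1}^r W_{ik}\theta_{k+1}$. Feasible set: all triples $(W,H,\theta)$ with $W\in\mathbb{R}^{n\times r}_{\ge 0}$, $H\in\mathbb{R}^{r\times m}_{\ge 0}$, $\theta\in\mathbb{R}^{r+1}$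 satisfying the normalization $\sum_{j=1}^m H_{ij}=1$ for every $i=1,\dots,r$. Global minimizer of the CSSNMF problem with weight $\lambda$: - If $\lambda>0$: a feasible triple $(W^{(\lambda)},H^{(\lambda)},\theta^{(\lambda)})$ minimizing $F^{(\lambda)}(\cdot,\cdot,\cdot;X,Y)$ over all feasible triples. - If $\lambda=0$: a feasible triple $(W^{(0)},H^{(0)},\theta^{(0)})$ such that $(W^{(0)},H^{(0)})$ minimizes $N(W,H;X)$ over all $W\in\mathbb{R}^{n\times r}_{\ge 0}$ and $H\in\mathbb{R}^{r\times m}_{\ge 0}$ with row sums of $H$ equal to $1$, and then $\theta^{(0)}$ minimizes $R(W^{(0)},\theta;Y)$ over $\theta\in\mathbb{R}^{r+1}$. Uniqueness up to rescaling equivalence: a global minimizer $(W,H,\theta)$ (for a given weight) is called unique up to the rescaling equivalence if every global minimizer for that weight is of the form $(WS,\;S^{-1}H,\;(\theta_1,S^{-1}\theta_{2:(r+1)}))$ for some invertible $S\in\mathbb{R}^{r\times r}_{\ge 0}$ with $S^{-1}\in\mathbb{R}^{r\times r}_{\ge 0}$, where $\theta_{2:(r+1)}=(\theta_2,\dots,\theta_{r+1})^T$. *)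

theory Defs
  imports "HOL-Analysis.Analysis"
begin

text \<open>
  An \<open>n \<times> m\<close> matrix has type \<open>real ^ 'm ^ 'n\<close>, with \<open>A $ i $ j\<close> the entry in row \<open>i\<close> and
  column \<open>j\<close>. A vector in \<open>\<real>\<^sup>r\<^sup>+\<^sup>1\<close> has type \<open>real ^ ('r option)\<close>: index \<open>None\<close> is the first
  coordinate \<open>\<theta>\<^sub>1\<close> (the intercept) and \<open>Some k\<close> is the coordinate \<open>\<theta>\<^sub>k\<^sub>+\<^sub>1\<close>.
\<close>

definition nonneg_matrix :: "real ^ 'b ^ 'a \<Rightarrow> bool" where
  "nonneg_matrix A \<longleftrightarrow> (\<forall>i j. 0 \<le> A $ i $ j)"

definition prepend_ones :: "real ^ 'r ^ 'n \<Rightarrow> real ^ ('r::finite option) ^ 'n" where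
  "prepend_ones W = (\<chi> i j. case j of None \<Rightarrow> 1 | Some k \<Rightarrow> W $ i $ k)"

text \<open>The norm on \<open>real ^ 'm ^ 'n\<close> is the Frobenius norm.\<close>

definition nmf_error :: "real ^ 'm ^ 'n \<Rightarrow> real ^ 'r ^ 'n \<Rightarrow> real ^ 'm ^ 'r \<Rightarrow> real" where
  "nmf_error X W H = (norm (X - W ** H))\<^sup>2"

definition regression_error ::
    "real ^ 'n \<Rightarrow> real ^ 'r ^ 'n \<Rightarrow> real ^ ('r::finite option) \<Rightarrow> real" where
  "regression_error Y W \<theta> = (norm (prepend_ones W *v \<theta> - Y))\<^sup>2"

definition cssnmf_objective ::
    "real \<Rightarrow> real ^ 'm ^ 'n \<Rightarrow> real ^ 'n \<Rightarrow>
      real ^ 'r ^ 'n \<Rightarrow> real ^ 'm ^ 'r \<Rightarrow> real ^ ('r::finite option) \<Rightarrow> real" where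
  "cssnmf_objective lam X Y W H \<theta> = nmf_error X W H + lam * regression_error Y W \<theta>"

text \<open>Feasibility puts no constraint on \<open>\<theta>\<close>.\<close>

definition feasible_factors :: "real ^ 'r ^ 'n \<Rightarrow> real ^ 'm ^ 'r \<Rightarrow> bool" where
  "feasible_factors W H \<longleftrightarrow>
     nonneg_matrix W \<and> nonneg_matrix H \<and> (\<forall>i. (\<Sum>j\<in>UNIV. H $ i $ j) = 1)"

text \<open>For \<open>lam = 0\<close> the problem is solved in two stages: factorization, then regression.\<close>

definition cssnmf_global_minimizer ::
    "real \<Rightarrow> real ^ 'm ^ 'n \<Rightarrow> real ^ 'n \<Rightarrow>
      real ^ 'r ^ 'n \<Rightarrow> real ^ 'm ^ 'r \<Rightarrow> real ^ ('r::finite option) \<Rightarrow> bool" where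
  "cssnmf_global_minimizer lam X Y W H \<theta> \<longleftrightarrow>
     feasible_factors W H \<and>
     (lam > 0 \<and>
        (\<forall>(W' :: real ^ 'r ^ 'n) H' \<theta>'. feasible_factors W' H' \<longrightarrow>
           cssnmf_objective lam X Y W H \<theta> \<le> cssnmf_objective lam X Y W' H' \<theta>')
      \<or> lam = 0 \<and>
        (\<forall>(W' :: real ^ 'r ^ 'n) H'. feasible_factors W' H' \<longrightarrow>
           nmf_error X W H \<le> nmf_error X W' H') \<and>
        (\<forall>\<theta>'. regression_error Y W \<theta> \<le> regression_error Y W \<theta>'))"

definition rescale_theta :: "real ^ 'r ^ 'r \<Rightarrow> real ^ ('r::finite option) \<Rightarrow> real ^ ('r option)" where
  "rescale_theta A \<theta> =
     (\<chi> j. case j of None \<Rightarrow> \<theta> $ None | Some k \<Rightarrow> (A *v (\<chi> l. \<theta> $ Some l)) $ k)"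

definition cssnmf_unique_global_minimizer ::
    "real \<Rightarrow> real ^ 'm ^ 'n \<Rightarrow> real ^ 'n \<Rightarrow>
      real ^ 'r ^ 'n \<Rightarrow> real ^ 'm ^ 'r \<Rightarrow> real ^ ('r::finite option) \<Rightarrow> bool" where
  "cssnmf_unique_global_minimizer lam X Y W H \<theta> \<longleftrightarrow>
     cssnmf_global_minimizer lam X Y W H \<theta> \<and>
     (\<forall>W' H' \<theta>'. cssnmf_global_minimizer lam X Y W' H' \<theta>' \<longrightarrow>
        (\<exists>S :: real ^ 'r ^ 'r.
           invertible S \<and> nonneg_matrix S \<and> nonneg_matrix (matrix_inv S) \<and>
           W' = W ** S \<and> H' = matrix_inv S ** H \<and> \<theta>' = rescale_theta (matrix_inv S) \<theta>))"

end

theory Submission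
  imports Defs
begin

text \<open>
  Each minimizer is compared with the other one in its own objective. Adding the two inequalities
  cancels the factorization errors and leaves \<open>(lam2 - lam1) * (R1 - R2) \<ge> 0\<close>.
\<close>

text \<open>For \<open>lam = 0\<close> the objective is the factorization error alone, so this covers the two-stage case.\<close>

lemma cssnmf_global_minimizer_objective_le:
  fixes W W' :: "real ^ ('r::finite) ^ 'n"
  assumes "cssnmf_global_minimizer lam X Y W H \<theta>" and "feasible_factors W' H'"
  shows "cssnmf_objective lam X Y W H \<theta> \<le> cssnmf_objective lam X Y W' H' \<theta>'"
  using assms by (auto simp: cssnmf_global_minimizer_def cssnmf_objective_def)

theorem theorem1:
  fixes X :: "real ^ 'm ^ 'n" and Y :: "real ^ 'n"
    and lam1 lam2 :: real
    and W1 W2 :: "real ^ ('r::finite) ^ 'n"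
    and H1 H2 :: "real ^ 'm ^ 'r"
    and \<theta>1 \<theta>2 :: "real ^ ('r option)"
  assumes "nonneg_matrix X"
    and "0 \<le> lam1" and "lam1 < lam2"
    and "cssnmf_unique_global_minimizer lam1 X Y W1 H1 \<theta>1"
    and "cssnmf_unique_global_minimizer lam2 X Y W2 H2 \<theta>2"
  shows "regression_error Y W2 \<theta>2 \<le> regression_error Y W1 \<theta>1"
proof -
  have min1: "cssnmf_global_minimizer lam1 X Y W1 H1 \<theta>1"
    and min2: "cssnmf_global_minimizer lam2 X Y W2 H2 \<theta>2"
    using assms by (simp_all add: cssnmf_unique_global_minimizer_def)
  \<comment> \<open>Feasibility does not depend on the weight, so each factor pair is an admissible
    competitor in the other problem.\<close>
  then have feas: "feasible_factors W1 H1" "feasible_factors W2 H2"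
    by (simp_all add: cssnmf_global_minimizer_def)
  have "nmf_error X W1 H1 + lam1 * regression_error Y W1 \<theta>1
      \<le> nmf_error X W2 H2 + lam1 * regression_error Y W2 \<theta>2"
    \<comment> \<open>The competitor's \<open>\<theta>'\<close> is arbitrary in the bound; here it
      is taken to be \<open>\<theta>2\<close>.\<close>
    using cssnmf_global_minimizer_objective_le[OF min1 feas(2)]
    by (simp add: cssnmf_objective_def)
  moreover have "nmf_error X W2 H2 + lam2 * regression_error Y W2 \<theta>2
      \<le> nmf_error X W1 H1 + lam2 * regression_error Y W1 \<theta>1"
    using cssnmf_global_minimizer_objective_le[OF min2 feas(1)]
    by (simp add: cssnmf_objective_def)
  ultimately have "(lam2 - lam1) * regression_error Y W2 \<theta>2
      \<le> (lam2 - lam1) * regression_error Y W1 \<theta>1"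
    by (simp add: left_diff_distrib)
  \<comment> \<open>Strictness of \<open>lam1 < lam2\<close> makes the common factor positive, so it
    cancels without reversing the inequality.\<close>
  then show ?thesis
    using \<open>lam1 < lam2\<close> by simp
qed

end
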